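(* Let $E\subset\mathbb{R}$ be an achievable set. Then $E$ is a finite union of closed intervals if and only if there exist two representations $(x_n)$ and $(y_n)$ of $E$ such that the intersection $\{x_n : n\in\mathbb{N}\}\cap\{y_n : n\in\mathbb{N}\}$ is finite.
   Context: All sequences $(x_n)_{n\in\mathbb{N}}$ considered are infinite, non-increasing, summable sequences of positive real numbers. The achievement set (set of subsums) of $(x_n)$ is $E(x_n)=\{\sum_{n\in A}x_n : A\subset\mathbb{N}\}$. A set $E\subset\mathbb{R}$ is achievable if $E=E(x_n)$ for some such sequence $(x_n)$, and every such sequence $(x_n)$ with $E(x_n)=E$ is called a representation of $E$. *)

theory Defs
  imports "HOL-Analysis.Analysis"
begin

definition admissible_seq :: "(nat \<Rightarrow> real) \<Rightarrow> bool" where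
  "admissible_seq x \<longleftrightarrow> (\<forall>n. 0 < x n) \<and> decseq x \<and> summable x"

definition achievement_set :: "(nat \<Rightarrow> real) \<Rightarrow> real set" where
  "achievement_set x = range (\<lambda>A. \<Sum>\<^sub>\<infinity>n\<in>A. x n)"

definition representation_of :: "(nat \<Rightarrow> real) \<Rightarrow> real set \<Rightarrow> bool" where
  "representation_of x E \<longleftrightarrow> admissible_seq x \<and> achievement_set x = E"

definition achievable :: "real set \<Rightarrow> bool" where
  "achievable E \<longleftrightarrow> (\<exists>x. representation_of x E)"

(* Only bounded intervals are needed, because achievement sets are bounded.  Degenerate
   intervals {a} are allowed; since achievement sets have no isolated points, requiring
   a < b instead would give the same notion for them. *)
definition finite_union_of_closed_intervals :: "real set \<Rightarrow> bool" where
  "finite_union_of_closed_intervals E \<longleftrightarrow>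
     (\<exists>F. finite F \<and> (\<forall>I\<in>F. \<exists>a b. a \<le> b \<and> I = {a..b}) \<and> E = \<Union>F)"

end

theory Submission
  imports Defs
begin

text \<open>
  Call the right endpoint \<open>b\<close> of a gap of \<open>E\<close> dominating if all gaps further to the left are
  strictly shorter. Such a \<open>b\<close> is a term of every representation of \<open>E\<close>: if \<open>b\<close> were a sum of
  several terms, one could replace the smallest of them, \<open>x\<^sub>i\<close>, by a slightly smaller element of
  \<open>E\<close>, which uses only terms after \<open>x\<^sub>i\<close>, and land inside the gap. If \<open>x\<^sub>k\<close> exceeds the sum of the
  later terms for infinitely many \<open>k\<close>, then \<open>E\<close> has gaps arbitrarily close to 0, hence infinitely
  many dominating ones, and any two representations share infinitely many terms.

  Otherwise Kakeya's greedy argument shows that some tail of the sequence fills a whole interval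
  \<open>[0, r]\<close>, so that \<open>E\<close> is a finite union of translates of it. The tail may then be replaced by
  \<open>r m\<^sup>k / (m + 1)\<^sup>k\<^sup>+\<^sup>1\<close> for any large \<open>m\<close>; by parity, an even and an odd \<open>m\<close> give tails without
  common terms.
\<close>

section \<open>Subsums and tails of an admissible sequence\<close>

lemma admissible_seqD:
  assumes "admissible_seq x"
  shows "0 < x n" "i \<le> j \<Longrightarrow> x j \<le> x i" "summable x" "x \<longlonglongrightarrow> 0" "x summable_on A"
proof -
  show "0 < x n" "i \<le> j \<Longrightarrow> x j \<le> x i" and s: "summable x"
    using assms by (auto simp: admissible_seq_def decseq_def)
  show "x \<longlonglongrightarrow> 0"
    using s by (rule summable_LIMSEQ_zero)
  have "x summable_on UNIV"
    using assms s by (intro norm_summable_imp_summable_on)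
      (simp add: admissible_seq_def less_imp_le)
  then show "x summable_on A"
    by (rule summable_on_subset_banach) simp
qed

lemma subsum_mono:
  assumes "admissible_seq x" "A \<subseteq> B"
  shows "infsum x A \<le> infsum x B"
  using admissible_seqD[OF assms(1)] assms(2)
  by (intro infsum_mono_neutral) (auto intro: less_imp_le)

lemma subsum_nonneg: "admissible_seq x \<Longrightarrow> 0 \<le> infsum x A"
  by (intro infsum_nonneg less_imp_le admissible_seqD(1))

lemma subsum_Un_disjoint:
  "admissible_seq x \<Longrightarrow> A \<inter> B = {} \<Longrightarrow> infsum x (A \<union> B) = infsum x A + infsum x B"
  by (intro infsum_Un_disjoint admissible_seqD(5))

lemma subsum_remove:
  assumes "admissible_seq x" "i \<in> A"
  shows "infsum x A = x i + infsum x (A - {i})"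
  using subsum_Un_disjoint[OF assms(1), of "{i}" "A - {i}"] assms(2) by (simp add: insert_absorb)

lemma member_le_subsum:
  assumes "admissible_seq x" "i \<in> A"
  shows "x i \<le> infsum x A"
  using subsum_remove[OF assms] subsum_nonneg[OF assms(1), of "A - {i}"] by simp

lemma subsum_split:
  assumes "admissible_seq x"
  shows "infsum x A = sum x (A \<inter> {..<n}) + infsum x (A \<inter> {n..})"
proof -
  have "A = (A \<inter> {..<n}) \<union> (A \<inter> {n..})"
    by auto
  then have "infsum x A = infsum x (A \<inter> {..<n}) + infsum x (A \<inter> {n..})"
    using subsum_Un_disjoint[OF assms, of "A \<inter> {..<n}" "A \<inter> {n..}"] by fastforce
  then show ?thesis
    by simp
qed

lemma tail_Suc:
  assumes "admissible_seq x"
  shows "infsum x {n..} = x n + infsum x {Suc n..}"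
proof -
  have "{n..} - {n} = {Suc n..}"
    by auto
  then show ?thesis
    using subsum_remove[OF assms, of n "{n..}"] by simp
qed

lemma tail_eq_suminf:
  assumes "admissible_seq x"
  shows "infsum x {n..} = (\<Sum>k. x (k + n))"
proof -
  have "(x has_sum suminf x) UNIV"
    using admissible_seqD[OF assms] by (intro norm_summable_imp_has_sum summable_sums)
      (auto simp: abs_of_pos)
  then have "infsum x UNIV = suminf x"
    by (rule infsumI)
  then show ?thesis
    using subsum_split[OF assms, of UNIV n]
      suminf_minus_initial_segment[OF admissible_seqD(3)[OF assms], of n]
    by simp
qed

lemma tail_tendsto_0:
  assumes "admissible_seq x"
  shows "(\<lambda>n. infsum x {n..}) \<longlonglongrightarrow> 0"
  using suminf_exist_split2[OF admissible_seqD(3)[OF assms]]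
  by (simp add: tail_eq_suminf[OF assms])

lemma mem_achievement_set: "infsum x A \<in> achievement_set x"
  unfolding achievement_set_def by blast

lemma term_mem_achievement_set: "x n \<in> achievement_set x"
  using mem_achievement_set[of x "{n}"] by simp

lemma subsum_less_term:
  assumes "admissible_seq x" "infsum x A < x k"
  shows "A \<subseteq> {Suc k..}"
proof
  fix j assume "j \<in> A"
  then have "x j < x k"
    using member_le_subsum[OF assms(1)] assms(2) by fastforce
  then show "j \<in> {Suc k..}"
    using admissible_seqD(2)[OF assms(1), of j k] by (meson atLeast_iff leD not_less_eq_eq)
qed

text \<open>A subsum below \<open>x k\<close> uses only indices after \<open>k\<close>, so it is at
  most the whole tail behind \<open>k\<close>. When that tail is smaller than \<open>x k\<close>, a
  genuine gap ends at \<open>x k\<close>.\<close>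

lemma gap_before_term:
  assumes "admissible_seq x"
  shows "achievement_set x \<inter> {infsum x {Suc k..}<..<x k} = {}"
proof -
  have "infsum x A \<le> infsum x {Suc k..}" if "infsum x A < x k" for A
    using subsum_mono[OF assms subsum_less_term[OF assms that]] .
  then show ?thesis
    by (force simp: achievement_set_def)
qed


section \<open>Kakeya's theorem\<close>

text \<open>Greedy choice: run through the indices from \<open>N\<close> on and take each term that
  still fits below \<open>t\<close>. Slowness guarantees that what is left over can always be
  covered by the remaining terms.\<close>

lemma tail_subsums_interval:
  fixes x :: "nat \<Rightarrow> real"
  assumes x: "admissible_seq x"
    and slow: "\<And>k. N \<le> k \<Longrightarrow> x k \<le> infsum x {Suc k..}"
    and t: "0 \<le> t" "t \<le> infsum x {N..}"
  obtains A where "A \<subseteq> {N..}" "infsum x A = t"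
proof
  define s where "s = rec_nat 0 (\<lambda>n u. if N \<le> n \<and> u + x n \<le> t then u + x n else u)"
  define A where "A = {n. N \<le> n \<and> s n + x n \<le> t}"
  have s0: "s 0 = 0"
    and s_Suc: "s (Suc n) = (if n \<in> A then s n + x n else s n)" for n
    by (simp_all add: s_def A_def)
  have s_eq: "s n = sum x (A \<inter> {..<n})" for n
    by (induction n) (auto simp: s0 s_Suc lessThan_Suc Int_insert_right)
  have bounds: "s n \<le> t \<and> t - s n \<le> infsum x {n..}" if "N \<le> n" for n
    using that
  proof (induction n rule: nat_induct_at_least)
    case base
    have "A \<inter> {..<N} = {}"
      by (auto simp: A_def)
    then show ?case
      using t by (simp add: s_eq)
  next
    case (Suc n)
    then show ?case
      using tail_Suc[OF x, of n] slow[of n] by (auto simp: s_Suc A_def)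
  qed
  show "A \<subseteq> {N..}"
    by (auto simp: A_def)
  have near: "\<bar>infsum x A - t\<bar> \<le> infsum x {n..}" if "N \<le> n" for n
    using bounds[OF that] subsum_split[OF x, of A n] s_eq[of n]
      subsum_nonneg[OF x, of "A \<inter> {n..}"] subsum_mono[OF x, of "A \<inter> {n..}" "{n..}"]
    by auto
  have "\<bar>infsum x A - t\<bar> \<le> 0"
    using near by (intro LIMSEQ_le_const[OF tail_tendsto_0[OF x]]) blast
  then show "infsum x A = t"
    by simp
qed

text \<open>The indices below \<open>N\<close> select a translate, and the tail fills an interval.
  The right-hand side depends only on the first \<open>N\<close> terms and the tail sum, which is
  what allows the tail to be exchanged later.\<close>

lemma achievement_set_eq_Union:
  assumes x: "admissible_seq x"
    and slow: "\<And>k. N \<le> k \<Longrightarrow> x k \<le> infsum x {Suc k..}"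
  shows "achievement_set x = (\<Union>F\<in>Pow {..<N}. {sum x F..sum x F + infsum x {N..}})"
proof (intro equalityI subsetI)
  fix e assume "e \<in> achievement_set x"
  then obtain A where "e = infsum x A"
    by (auto simp: achievement_set_def)
  then have "e = sum x (A \<inter> {..<N}) + infsum x (A \<inter> {N..})"
    using subsum_split[OF x] by simp
  moreover have "infsum x (A \<inter> {N..}) \<le> infsum x {N..}"
    by (intro subsum_mono x) auto
  ultimately show "e \<in> (\<Union>F\<in>Pow {..<N}. {sum x F..sum x F + infsum x {N..}})"
    using subsum_nonneg[OF x, of "A \<inter> {N..}"] by (intro UN_I[of "A \<inter> {..<N}"]) auto
next
  fix e assume "e \<in> (\<Union>F\<in>Pow {..<N}. {sum x F..sum x F + infsum x {N..}})"
  then obtain F where F: "F \<subseteq> {..<N}" "sum x F \<le> e" "e \<le> sum x F + infsum x {N..}"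
    by auto
  obtain A where A: "A \<subseteq> {N..}" "infsum x A = e - sum x F"
    by (rule tail_subsums_interval[OF x slow, where t = "e - sum x F"]) (use F in auto)
  have "infsum x (F \<union> A) = infsum x F + infsum x A"
    using F(1) A(1) by (intro subsum_Un_disjoint x) fastforce
  also have "\<dots> = e"
    using A(2) F(1) finite_subset[OF F(1)] by simp
  finally show "e \<in> achievement_set x"
    using mem_achievement_set by metis
qed

lemma finite_union_if_slow:
  assumes "admissible_seq x"
    and "\<And>k. N \<le> k \<Longrightarrow> x k \<le> infsum x {Suc k..}"
  shows "finite_union_of_closed_intervals (achievement_set x)"
  unfolding finite_union_of_closed_intervals_def
proof (rule exI, intro conjI ballI)
  show "finite ((\<lambda>F. {sum x F..sum x F + infsum x {N..}}) ` Pow {..<N})"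
    by simp
  show "achievement_set x = \<Union>((\<lambda>F. {sum x F..sum x F + infsum x {N..}}) ` Pow {..<N})"
    using assms by (rule achievement_set_eq_Union)
  fix I assume "I \<in> (\<lambda>F. {sum x F..sum x F + infsum x {N..}}) ` Pow {..<N}"
  then obtain F where "I = {sum x F..sum x F + infsum x {N..}}"
    by blast
  then show "\<exists>a b. a \<le> b \<and> I = {a..b}"
    using subsum_nonneg[OF assms(1), of "{N..}"]
    by (intro exI[of _ "sum x F"] exI[of _ "sum x F + infsum x {N..}"]) simp
qed

text \<open>By pigeonhole one of the intervals contains infinitely many terms. As the terms tend to
  0, it reaches down to 0, and so leaves no room for a gap just before a small term.\<close>

lemma slow_if_finite_union:
  assumes x: "admissible_seq x"
    and fin: "finite_union_of_closed_intervals (achievement_set x)"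
  obtains N where "\<And>k. N \<le> k \<Longrightarrow> x k \<le> infsum x {Suc k..}"
proof -
  obtain F where F: "finite F" "\<And>I. I \<in> F \<Longrightarrow> \<exists>a b. I = {a..b}" "achievement_set x = \<Union>F"
    using fin unfolding finite_union_of_closed_intervals_def by metis
  have "(\<Union>I\<in>F. {n. x n \<in> I}) = UNIV"
    using term_mem_achievement_set[of x] F(3) by auto
  then obtain I where I: "I \<in> F" "infinite {n. x n \<in> I}"
    using F(1) by (metis finite_UN infinite_UNIV_nat)
  obtain a b where ab: "I = {a..b}"
    using F(2)[OF I(1)] by blast
  obtain N where N: "x N \<in> I"
    using I(2) by (metis (mono_tags, lifting) Collect_empty_eq finite.emptyI)
  have "a \<le> 0"
  proof (rule ccontr)
    assume "\<not> a \<le> 0"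
    then have "eventually (\<lambda>n. x n < a) sequentially"
      using order_tendstoD(2)[OF admissible_seqD(4)[OF x]] by simp
    then obtain M where "\<And>n. M \<le> n \<Longrightarrow> x n < a"
      by (auto simp: eventually_sequentially)
    then have "{n. x n \<in> I} \<subseteq> {..<M}"
      using ab by (auto simp: not_less[symmetric])
    then show False
      using I(2) finite_subset by blast
  qed
  then have filled: "{0..x N} \<subseteq> achievement_set x"
    using F(3) I(1) N ab by auto
  have "x k \<le> infsum x {Suc k..}" if "N \<le> k" for k
  proof (rule ccontr)
    assume "\<not> x k \<le> infsum x {Suc k..}"
    then obtain c where c: "infsum x {Suc k..} < c" "c < x k"
      using dense by (metis not_le)
    then have "c \<in> {0..x N}"
      using subsum_nonneg[OF x, of "{Suc k..}"] admissible_seqD(2)[OF x that] by auto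
    then show False
      using c filled gap_before_term[OF x, of k] by (metis disjoint_iff greaterThanLessThan_iff subsetD)
  qed
  then show thesis
    by (rule that)
qed


section \<open>Replacing the tail\<close>

text \<open>The geometric tail has the same sum as the old one and is slow as well, so both
  sequences yield the same union of intervals. The bound by \<open>x N\<close> keeps the sequence
  non-increasing where the new tail starts.\<close>

lemma replace_tail:
  fixes m :: nat
  assumes x: "admissible_seq x"
    and slow: "\<And>k. N \<le> k \<Longrightarrow> x k \<le> infsum x {Suc k..}"
    and m: "0 < m" "infsum x {N..} / real (Suc m) \<le> x N"
  defines "y \<equiv> \<lambda>k. if k < N then x k
    else infsum x {N..} / real (Suc m) * (real m / real (Suc m)) ^ (k - N)"
  shows "representation_of y (achievement_set x)"
proof -
  define r where "r = infsum x {N..}"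
  define q where "q = real m / real (Suc m)"
  have r: "0 < r"
    using member_le_subsum[OF x, of N "{N..}"] admissible_seqD(1)[OF x, of N] by (simp add: r_def)
  have q: "0 < q" "q < 1"
    using m by (auto simp: q_def)
  have y_eq: "y k = (if k < N then x k else r / Suc m * q ^ (k - N))" for k
    by (simp add: y_def r_def q_def)
  \<comment> \<open>The factor \<open>1 / (1 - q) = Suc m\<close> cancels the denominator of the
    leading coefficient.\<close>
  have geo: "(\<lambda>k. y (k + n)) sums (r * q ^ (n - N))" if "N \<le> n" for n
  proof -
    have "(\<lambda>k. r / Suc m * q ^ (n - N) * q ^ k) sums (r / Suc m * q ^ (n - N) * (1 / (1 - q)))"
      using q by (intro sums_mult geometric_sums) auto
    moreover have "1 / (1 - q) = Suc m"
      by (simp add: q_def field_simps)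
    moreover have "r / Suc m * q ^ (n - N) * q ^ k = y (k + n)" for k
      using that by (simp add: y_eq power_add[symmetric] add.commute)
    ultimately show ?thesis
      by (simp del: of_nat_Suc)
  qed
  have "summable y"
    using sums_summable[OF geo[of N]] summable_iff_shift[of y N] by blast
  moreover have "y (Suc k) \<le> y k" for k
  proof -
    consider "Suc k < N" | "Suc k = N" | "N \<le> k"
      by linarith
    then show ?thesis
    proof cases
      case 2
      then have "y (Suc k) \<le> x N"
        using m by (simp add: y_eq r_def)
      then show ?thesis
        using 2 admissible_seqD(2)[OF x, of k N] by (simp add: y_eq)
    next
      case 3
      then have "q ^ (Suc k - N) \<le> q ^ (k - N)"
        using q by (intro power_decreasing) auto
      then show ?thesis
        using 3 r by (auto simp: y_eq intro!: mult_left_mono divide_right_mono)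
    qed (use admissible_seqD(2)[OF x, of k "Suc k"] in \<open>simp add: y_eq\<close>)
  qed
  ultimately have y: "admissible_seq y"
    using admissible_seqD(1)[OF x] r q by (auto simp: admissible_seq_def y_eq intro!: decseq_SucI)
  have tail: "infsum y {n..} = r * q ^ (n - N)" if "N \<le> n" for n
    using sums_unique[OF geo[OF that]] tail_eq_suminf[OF y, of n] by simp
  have "y k \<le> infsum y {Suc k..}" if "N \<le> k" for k
  proof -
    \<comment> \<open>This is \<open>1 \<le> m\<close>; after scaling it says that each term of the
      new tail is at most the sum of its successors.\<close>
    have "1 / real (Suc m) \<le> q"
      using m by (auto simp: q_def divide_simps)
    then have "r * q ^ (k - N) * (1 / real (Suc m)) \<le> r * q ^ (k - N) * q"
      using r q by (intro mult_left_mono) auto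
    then show ?thesis
      using that by (simp add: tail y_eq Suc_diff_le mult_ac)
  qed
  then have "achievement_set y = (\<Union>F\<in>Pow {..<N}. {sum y F..sum y F + infsum y {N..}})"
    by (rule achievement_set_eq_Union[OF y])
  also have "\<dots> = (\<Union>F\<in>Pow {..<N}. {sum x F..sum x F + infsum x {N..}})"
  proof (rule SUP_cong)
    fix F assume "F \<in> Pow {..<N}"
    then have "sum y F = sum x F"
      by (intro sum.cong) (auto simp: y_eq)
    then show "{sum y F..sum y F + infsum y {N..}} = {sum x F..sum x F + infsum x {N..}}"
      by (simp add: tail r_def)
  qed simp
  also have "\<dots> = achievement_set x"
    using achievement_set_eq_Union[OF x slow] by simp
  finally show ?thesis
    using y by (simp add: representation_of_def)
qed

lemma geometric_terms_neq:
  fixes r :: real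
  assumes "r \<noteq> 0" "even m" "m' = Suc m"
  shows "r / real (Suc m) * (real m / real (Suc m)) ^ i
    \<noteq> r / real (Suc m') * (real m' / real (Suc m')) ^ j"
proof
  assume "r / real (Suc m) * (real m / real (Suc m)) ^ i
    = r / real (Suc m') * (real m' / real (Suc m')) ^ j"
  then have "r * (real m ^ i / real (Suc m) ^ Suc i) = r * (real m' ^ j / real (Suc m') ^ Suc j)"
    by (simp add: power_divide del: of_nat_Suc)
  then have "real m ^ i / real (Suc m) ^ Suc i = real m' ^ j / real (Suc m') ^ Suc j"
    using assms(1) by (simp only: mult_cancel_left) simp
  then have "real m ^ i * real (Suc m') ^ Suc j = real m' ^ j * real (Suc m) ^ Suc i"
    by (simp add: frac_eq_eq del: of_nat_Suc power_Suc)
  then have "m ^ i * Suc m' ^ Suc j = m' ^ j * Suc m ^ Suc i"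
    by (metis (no_types, lifting) of_nat_eq_iff of_nat_mult of_nat_power)
  \<comment> \<open>The exponent \<open>Suc j\<close> is positive, so the even factor
    \<open>Suc m'\<close> does occur; on the other side both bases are odd.\<close>
  moreover have "even (m ^ i * Suc m' ^ Suc j)"
    using assms by simp
  moreover have "odd (m' ^ j * Suc m ^ Suc i)"
    using assms by simp
  ultimately show False
    by metis
qed

lemma two_representations_if_slow:
  assumes x: "admissible_seq x"
    and slow: "\<And>k. N \<le> k \<Longrightarrow> x k \<le> infsum x {Suc k..}"
  shows "\<exists>y z. representation_of y (achievement_set x) \<and> representation_of z (achievement_set x) \<and>
    finite (range y \<inter> range z)"
proof -
  define r where "r = infsum x {N..}"
  define y where "y m = (\<lambda>k. if k < N then x k
    else r / real (Suc m) * (real m / real (Suc m)) ^ (k - N))" for m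
  have xN: "0 < x N" "x N \<le> r"
    using admissible_seqD(1)[OF x] member_le_subsum[OF x] by (auto simp: r_def)
  \<comment> \<open>For every \<open>m \<ge> t\<close> the leading term \<open>r / Suc m\<close> of
    the new tail is then at most \<open>x N\<close>.\<close>
  obtain t :: nat where t: "r / x N < t"
    using reals_Archimedean2 by blast
  have t_pos: "0 < t"
    using t xN by (cases t) (auto simp: divide_less_0_iff)
  have rep: "representation_of (y m) (achievement_set x)" if "t \<le> m" for m
  proof -
    have "r / x N \<le> Suc m"
      using t that by linarith
    then have "r / Suc m \<le> x N"
      using xN by (simp add: divide_simps mult.commute)
    then show ?thesis
      using replace_tail[OF x, of N m] slow t_pos that unfolding y_def r_def by simp
  qed
  \<comment> \<open>The two geometric tails have no common value, so a shared value comes from the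
    common initial segment in at least one of the sequences.\<close>
  have "range (y (2 * t)) \<inter> range (y (Suc (2 * t))) \<subseteq> x ` {..<N}"
    using geometric_terms_neq[of r "2 * t" "Suc (2 * t)"] xN
    by (auto simp: y_def split: if_splits simp del: of_nat_Suc)
  then have "finite (range (y (2 * t)) \<inter> range (y (Suc (2 * t))))"
    by (rule finite_subset) simp
  then show ?thesis
    using rep[of "2 * t"] rep[of "Suc (2 * t)"] by auto
qed


section \<open>Dominating gaps\<close>

text \<open>The threshold \<open>\<delta>\<close> avoids measuring gaps: the gap ending at
  \<open>b\<close> has length at least \<open>\<delta>\<close>, every one further left is shorter.
  Only the set enters, not a representation of it.\<close>

definition dominating_gap_end :: "real set \<Rightarrow> real \<Rightarrow> bool" where
  "dominating_gap_end E b \<longleftrightarrow> b \<in> E \<and> 0 < b \<and>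
    (\<exists>\<delta>>0. E \<inter> {b - \<delta><..<b} = {} \<and> (\<forall>c\<in>E. 0 < c \<longrightarrow> c < b \<longrightarrow> E \<inter> {c - \<delta><..<c} \<noteq> {}))"

lemma dominating_gap_end_is_term:
  assumes x: "admissible_seq x" and "dominating_gap_end (achievement_set x) b"
  shows "b \<in> range x"
proof -
  define E where "E = achievement_set x"
  obtain \<delta> where \<delta>: "b \<in> E" "0 < b" "0 < \<delta>" "E \<inter> {b - \<delta><..<b} = {}"
    "\<And>c. c \<in> E \<Longrightarrow> 0 < c \<Longrightarrow> c < b \<Longrightarrow> E \<inter> {c - \<delta><..<c} \<noteq> {}"
    using assms(2) unfolding dominating_gap_end_def E_def by blast
  obtain A where A: "b = infsum x A"
    using \<delta>(1) by (auto simp: E_def achievement_set_def)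
  \<comment> \<open>Otherwise dropping a term smaller than \<open>\<delta>\<close> from the sum
    would land inside the gap before \<open>b\<close>.\<close>
  have "finite A"
  proof (rule ccontr)
    assume inf: "infinite A"
    obtain M where M: "\<And>n. M \<le> n \<Longrightarrow> x n < \<delta>"
      using order_tendstoD(2)[OF admissible_seqD(4)[OF x] \<delta>(3)]
      by (auto simp: eventually_sequentially)
    obtain i where i: "i \<in> A" "M \<le> i"
      using inf by (meson infinite_nat_iff_unbounded_le)
    have "b = x i + infsum x (A - {i})"
      using A subsum_remove[OF x i(1)] by simp
    then have "infsum x (A - {i}) \<in> E \<inter> {b - \<delta><..<b}"
      using M[OF i(2)] admissible_seqD(1)[OF x, of i] mem_achievement_set[of x] by (simp add: E_def)
    then show False
      using \<delta>(4) by auto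
  qed
  have "A \<noteq> {}"
    using A \<delta>(2) by auto
  define i where "i = Max A"
  have i: "i \<in> A" "\<And>j. j \<in> A \<Longrightarrow> j \<le> i"
    using \<open>finite A\<close> \<open>A \<noteq> {}\<close> by (auto simp: i_def)
  have b: "b = x i + infsum x (A - {i})"
    using A subsum_remove[OF x i(1)] by simp
  have "\<not> x i < b"
  proof
    assume "x i < b"
    then obtain e where e: "e \<in> E" "x i - \<delta> < e" "e < x i"
      using \<delta>(5)[of "x i"] admissible_seqD(1)[OF x, of i] term_mem_achievement_set[of x i]
      by (auto simp: E_def)
    then obtain B where B: "e = infsum x B"
      by (auto simp: E_def achievement_set_def)
    \<comment> \<open>Since \<open>i\<close> is the largest index in \<open>A\<close>, the indices
      of \<open>B\<close> are new, and \<open>x i\<close> can be exchanged for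
      \<open>e\<close>.\<close>
    have "B \<subseteq> {Suc i..}"
      using B e(3) by (intro subsum_less_term[OF x]) simp
    then have "(A - {i}) \<inter> B = {}"
      using i(2) by fastforce
    then have "infsum x ((A - {i}) \<union> B) = b - x i + e"
      using subsum_Un_disjoint[OF x] b B by simp
    then have "b - x i + e \<in> E"
      using mem_achievement_set[of x] E_def by metis
    then show False
      using \<delta>(4) e by auto
  qed
  then have "b = x i"
    using b subsum_nonneg[OF x, of "A - {i}"] by simp
  then show ?thesis
    by simp
qed

text \<open>Only finitely many points of \<open>E\<close> up to \<open>b\<^sub>0\<close> end a gap
  of length at least \<open>\<gamma>\<close>. Among them, the leftmost one with a longest gap is
  dominating.\<close>

lemma dominating_gap_end_below:
  assumes E: "0 \<in> E" and b\<^sub>0: "b\<^sub>0 \<in> E" "0 < b\<^sub>0"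
    and \<gamma>: "0 < \<gamma>" "E \<inter> {b\<^sub>0 - \<gamma><..<b\<^sub>0} = {}"
  obtains b where "b \<le> b\<^sub>0" "dominating_gap_end E b"
proof -
  \<comment> \<open>The length of the gap ending at \<open>b\<close>; the supremum is meaningful for
    \<open>0 < b\<close>, because \<open>0 \<in> E\<close> makes the set nonempty.\<close>
  define g where "g b = b - Sup (E \<inter> {..<b})" for b
  define S where "S = {b \<in> E. 0 < b \<and> b \<le> b\<^sub>0 \<and> E \<inter> {b - \<gamma><..<b} = {}}"
  \<comment> \<open>Distinct points of \<open>S\<close> are at least \<open>\<gamma>\<close> apart,
    so rounding in units of \<open>\<gamma>\<close> embeds \<open>S\<close> into a finite set of
    integers.\<close>
  have "\<lfloor>b / \<gamma>\<rfloor> < \<lfloor>b' / \<gamma>\<rfloor>" if "b \<in> S" "b' \<in> S" "b < b'" for b b'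
  proof -
    have "b \<le> b' - \<gamma>"
      using that by (force simp: S_def)
    then have "b / \<gamma> + 1 \<le> b' / \<gamma>"
      using divide_right_mono[of "b + \<gamma>" b' \<gamma>] \<gamma>(1) by (simp add: add_divide_distrib)
    then show ?thesis
      by linarith
  qed
  then have "inj_on (\<lambda>b. \<lfloor>b / \<gamma>\<rfloor>) S"
    by (intro linorder_inj_onI) (auto simp: less_le)
  moreover have "(\<lambda>b. \<lfloor>b / \<gamma>\<rfloor>) ` S \<subseteq> {0..\<lfloor>b\<^sub>0 / \<gamma>\<rfloor>}"
    using \<gamma> by (auto simp: S_def intro!: floor_mono divide_right_mono)
  ultimately have "finite S"
    by (meson finite_atLeastAtMost_int finite_imageD finite_subset)
  have "b\<^sub>0 \<in> S"
    using b\<^sub>0 \<gamma> by (simp add: S_def)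
  have gap: "E \<inter> {b - g b<..<b} = {}" for b
  proof -
    have "bdd_above (E \<inter> {..<b})"
      by (rule bdd_aboveI[of _ b]) auto
    then have "c \<le> b - g b" if "c \<in> E" "c < b" for c
      using that by (auto simp: g_def intro: cSup_upper)
    then show ?thesis
      by force
  qed
  have g_ge: "\<delta> \<le> g b" if "0 < b" "E \<inter> {b - \<delta><..<b} = {}" for b \<delta>
  proof -
    have "Sup (E \<inter> {..<b}) \<le> b - \<delta>"
    proof (rule cSup_least)
      show "E \<inter> {..<b} \<noteq> {}"
        using E that(1) by auto
    qed (use that(2) in force)
    then show ?thesis
      by (simp add: g_def)
  qed
  define T where "T = {b \<in> S. g b = Max (g ` S)}"
  have "Max (g ` S) \<in> g ` S"
    using \<open>finite S\<close> \<open>b\<^sub>0 \<in> S\<close> by (intro Max_in) auto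
  then have T: "finite T" "T \<noteq> {}"
    using \<open>finite S\<close> by (auto simp: T_def)
  define b where "b = Min T"
  have b: "b \<in> S" "g b = Max (g ` S)"
    using Min_in[OF T] by (auto simp: b_def T_def)
  have "\<gamma> \<le> g b"
    using b(1) by (intro g_ge) (auto simp: S_def)
  \<comment> \<open>A gap before \<open>c\<close> at least as long as that before \<open>b\<close>
    would put \<open>c\<close> in \<open>S\<close> and, by maximality, in \<open>T\<close>, although
    \<open>b\<close> is the least element of \<open>T\<close>.\<close>
  have "E \<inter> {c - g b<..<c} \<noteq> {}" if c: "c \<in> E" "0 < c" "c < b" for c
  proof
    assume empty: "E \<inter> {c - g b<..<c} = {}"
    have "E \<inter> {c - \<gamma><..<c} \<subseteq> E \<inter> {c - g b<..<c}"
      using \<open>\<gamma> \<le> g b\<close> by auto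
    then have "c \<in> S"
      using c b(1) empty by (auto simp: S_def)
    moreover have "g c = g b"
      using g_ge[OF c(2) empty] \<open>finite S\<close> \<open>c \<in> S\<close> b(2) by (intro antisym) auto
    ultimately have "c \<in> T"
      using b(2) by (simp add: T_def)
    then show False
      using Min_le[OF T(1), of c] c(3) by (simp add: b_def)
  qed
  then have "dominating_gap_end E b"
    unfolding dominating_gap_end_def
    using b(1) \<gamma>(1) \<open>\<gamma> \<le> g b\<close> gap[of b] by (auto simp: S_def intro!: exI[of _ "g b"])
  then show thesis
    using b(1) by (intro that) (auto simp: S_def)
qed

text \<open>Arbitrarily small terms have a gap before them, and each yields a dominating gap end no
  larger than itself. Hence these positive numbers have no minimum.\<close>

lemma infinite_dominating_gap_ends:
  assumes x: "admissible_seq x"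
    and fast: "\<And>N. \<exists>k\<ge>N. infsum x {Suc k..} < x k"
  shows "infinite {b. dominating_gap_end (achievement_set x) b}" (is "infinite ?D")
proof
  assume fin: "finite ?D"
  have ex: "\<exists>b\<in>?D. b < \<epsilon>" if "0 < \<epsilon>" for \<epsilon>
  proof -
    obtain N where N: "\<And>n. N \<le> n \<Longrightarrow> x n < \<epsilon>"
      using order_tendstoD(2)[OF admissible_seqD(4)[OF x] \<open>0 < \<epsilon>\<close>]
      by (auto simp: eventually_sequentially)
    obtain k where k: "N \<le> k" "infsum x {Suc k..} < x k"
      using fast by blast
    have "0 \<in> achievement_set x"
      using mem_achievement_set[of x "{}"] by simp
    then obtain b where "b \<le> x k" "dominating_gap_end (achievement_set x) b"
      using dominating_gap_end_below[of "achievement_set x" "x k" "x k - infsum x {Suc k..}"]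
        term_mem_achievement_set[of x k] admissible_seqD(1)[OF x, of k] k(2)
        gap_before_term[OF x, of k]
      by auto
    then show ?thesis
      using N[OF k(1)] by force
  qed
  have "?D \<noteq> {}"
    using ex[of 1] by auto
  then have "Min ?D \<in> ?D"
    using fin by (intro Min_in)
  then have "0 < Min ?D"
    by (simp add: dominating_gap_end_def)
  then obtain b where "b \<in> ?D" "b < Min ?D"
    using ex by blast
  then show False
    using Min_le[OF fin, of b] by simp
qed

theorem theorem1p5:
  fixes E :: "real set"
  assumes "achievable E"
  shows "finite_union_of_closed_intervals E \<longleftrightarrow>
    (\<exists>x y. representation_of x E \<and> representation_of y E \<and> finite (range x \<inter> range y))"
proof
  assume fin: "finite_union_of_closed_intervals E"
  obtain x where x: "admissible_seq x" "achievement_set x = E"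
    using assms by (auto simp: achievable_def representation_of_def)
  obtain N where "\<And>k. N \<le> k \<Longrightarrow> x k \<le> infsum x {Suc k..}"
    using slow_if_finite_union[OF x(1)] fin x(2) by blast
  then show "\<exists>x y. representation_of x E \<and> representation_of y E \<and> finite (range x \<inter> range y)"
    using two_representations_if_slow[OF x(1)] x(2) by blast
next
  assume "\<exists>x y. representation_of x E \<and> representation_of y E \<and> finite (range x \<inter> range y)"
  then obtain x y where x: "admissible_seq x" "achievement_set x = E"
    and y: "admissible_seq y" "achievement_set y = E" and fin: "finite (range x \<inter> range y)"
    by (auto simp: representation_of_def)
  \<comment> \<open>Dominating gap ends are determined by \<open>E\<close> alone, so both
    representations contain all of them.\<close>
  have "{b. dominating_gap_end E b} \<subseteq> range x \<inter> range y"
    using dominating_gap_end_is_term[OF x(1)] dominating_gap_end_is_term[OF y(1)] x(2) y(2) by auto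
  then have "finite {b. dominating_gap_end E b}"
    using fin finite_subset by blast
  then obtain N where "\<And>k. N \<le> k \<Longrightarrow> x k \<le> infsum x {Suc k..}"
    using infinite_dominating_gap_ends[OF x(1)] x(2) by (metis not_le)
  then show "finite_union_of_closed_intervals E"
    using finite_union_if_slow[OF x(1)] x(2) by blast
qed

end
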